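(* Let $\mathcal{A}$ be a cluster algebra. Covering pairs in $\mathcal{A}$ are relatively prime in $\mathcal{A}$: if $(a_1,a_2)$ is a covering pair in $\mathcal{A}$, then no prime ideal of $\mathcal{A}$ contains both $a_1$ and $a_2$ (equivalently, the ideal they generate is $\mathcal{A}$).
   Context: **Ice quivers and seeds.** An ice quiver $\mathsf{Q}$ is a finite quiver without loops or directed 2-cycles, together with a distinguished subset of vertices called frozen; the other vertices are called mutable. For vertices $i,j$ put $\mathsf{Q}_{ij}:=\#(\text{arrows from } i \text{ to } j)-\#(\text{arrows from } j\text{ to } i)$; this skew-symmetric integer matrix determines $\mathsf{Q}$. A seed $(\mathsf{Q},\mathbf{a})$ of rank $n$ is an ice quiver on vertices $1,\dots,n$ together with a cluster $\mathbf{a}=\{a_1,\dots,a_n\}$, an $n$-tuple of algebraically independent elements generating the field $\mathbb{Q}(x_1,\dots,x_n)$. **Mutation.** For a mutable vertex $k$, the mutation of $(\mathsf{Q},\mathbf{a})$ at $k$ is the seed $(\mu_k(\mathsf{Q}),\mu_k(\mathbf{a}))$ with the same frozen vertices, with $\mu_k(\mathsf{Q})_{ij}=-\mathsf{Q}_{ij}$ if $k\in\{i,j\}$ and $\mu_k(\mathsf{Q})_{ij}=\mathsf{Q}_{ij}+\frac{|\mathsf{Q}_{ik}|\mathsf{Q}_{kj}+\mathsf{Q}_{ik}|\mathsf{Q}_{kj}|}{2}$ otherwise, and with $\mu_k(a_i)=a_i$ for $i\neq k$ and $\mu_k(a_k)=\left(\prod_{\mathsf{Q}_{kj}>0}a_j^{\mathsf{Q}_{kj}}+\prod_{\mathsf{Q}_{kj}<0}a_j^{-\mathsf{Q}_{kj}}\right)a_k^{-1}$.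 Seeds related by finite sequences of mutations are mutation equivalent. **Cluster algebras.** The cluster algebra $\mathcal{A}(\mathsf{Q},\mathbf{a})$ is the subring of $\mathbb{Q}(x_1,\dots,x_n)$ generated by all cluster variables (the elements of the clusters of all seeds mutation equivalent to $(\mathsf{Q},\mathbf{a})$) and the inverses of the frozen variables. Those seeds are the seeds of $\mathcal{A}$. **Covering pairs.** A bi-infinite path in $\mathsf{Q}$ is a sequence of mutable vertices $(i_k)_{k\in\mathbb{Z}}$ with $\mathsf{Q}_{i_k,i_{k+1}}>0$ for all $k$; an arrow is in it if (after shifting indices) its source is $i_1$ and its target is $i_2$. A covering pair in $\mathsf{Q}$ is a pair of mutable vertices $(i,j)$ such that there is an arrow from $i$ to $j$ but this arrow is not in any bi-infinite path. A covering pair in a cluster algebra $\mathcal{A}$ is a pair of cluster variables $(a_1,a_2)$ such that some seed $(\mathsf{Q},\mathbf{a})$ of $\mathcal{A}$ has $a_1,a_2\in\mathbf{a}$ with corresponding vertices forming a covering pair in $\mathsf{Q}$. *)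

theory Defs
  imports
    "HOL-Library.Poly_Mapping"
    "HOL-Computational_Algebra.Fraction_Field"
    "HOL-Algebra.Algebra"
    "HOL-Algebra.Algebraic_Closure_Type"
begin

section \<open>The field of rational functions over the rationals\<close>

text \<open>
  A monomial is its exponent vector, of type \<open>nat \<Rightarrow>\<^sub>0 nat\<close>. The types below involve the countably
  many indeterminates \<open>x\<^sub>0, x\<^sub>1, x\<^sub>2, \<dots>\<close>; the field in \<open>x\<^sub>1, \<dots>, x\<^sub>n\<close> is the subfield
  \<open>ratfun_field n\<close>.
\<close>

type_synonym qpoly = "(nat \<Rightarrow>\<^sub>0 nat) \<Rightarrow>\<^sub>0 rat"
type_synonym ratfun = "qpoly fract"

definition ratfun_const :: "rat \<Rightarrow> ratfun" where
  "ratfun_const c = Fract (Poly_Mapping.single 0 c) 1"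

definition ratfun_var :: "nat \<Rightarrow> ratfun" where
  "ratfun_var i = Fract (Poly_Mapping.single (Poly_Mapping.single i 1) 1) 1"

definition ratfun_field :: "nat \<Rightarrow> ratfun ring" where
  "ratfun_field n =
     ring_of_type_algebra
       \<lparr>carrier := generate_field (ring_of_type_algebra :: ratfun ring) (ratfun_var ` {1..n})\<rparr>"

definition qpoly_eval :: "(nat \<Rightarrow> ratfun) \<Rightarrow> qpoly \<Rightarrow> ratfun" where
  "qpoly_eval a p =
     (\<Sum>m \<in> Poly_Mapping.keys p.
        ratfun_const (Poly_Mapping.lookup p m) *
        (\<Prod>i \<in> Poly_Mapping.keys m. a i ^ Poly_Mapping.lookup m i))"

definition algebraically_independent :: "nat \<Rightarrow> (nat \<Rightarrow> ratfun) \<Rightarrow> bool" where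
  "algebraically_independent n a \<longleftrightarrow>
     (\<forall>p. (\<forall>m \<in> Poly_Mapping.keys p. Poly_Mapping.keys m \<subseteq> {1..n}) \<longrightarrow>
          qpoly_eval a p = 0 \<longrightarrow> p = 0)"


section \<open>Ice quivers and seeds\<close>

text \<open>A quiver on the vertices \<open>1, \<dots>, n\<close> is given by the numbers \<open>arrows Q i j\<close> of arrows from
  \<open>i\<close> to \<open>j\<close>.\<close>

record ice_quiver =
  arrows :: "nat \<Rightarrow> nat \<Rightarrow> nat"
  frozen :: "nat set"

definition is_ice_quiver :: "nat \<Rightarrow> ice_quiver \<Rightarrow> bool" where
  "is_ice_quiver n Q \<longleftrightarrow>
     (\<forall>i j. arrows Q i j > 0 \<longrightarrow> i \<in> {1..n} \<and> j \<in> {1..n}) \<and>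
     (\<forall>i. arrows Q i i = 0) \<and>
     (\<forall>i j. \<not> (arrows Q i j > 0 \<and> arrows Q j i > 0)) \<and>
     frozen Q \<subseteq> {1..n}"

definition mutable :: "nat \<Rightarrow> ice_quiver \<Rightarrow> nat set" where
  "mutable n Q = {1..n} - frozen Q"

definition qmat :: "ice_quiver \<Rightarrow> nat \<Rightarrow> nat \<Rightarrow> int" where
  "qmat Q i j = int (arrows Q i j) - int (arrows Q j i)"

type_synonym seed = "ice_quiver \<times> (nat \<Rightarrow> ratfun)"

text \<open>Only the values of the cluster \<open>a\<close> at \<open>1, \<dots>, n\<close> matter.\<close>

definition is_seed :: "nat \<Rightarrow> seed \<Rightarrow> bool" where
  "is_seed n S \<longleftrightarrow>
     (case S of (Q, a) \<Rightarrow>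
        is_ice_quiver n Q \<and>
        algebraically_independent n a \<and>
        generate_field (ratfun_field n) (a ` {1..n}) = carrier (ratfun_field n))"


section \<open>Mutation\<close>

text \<open>The division by 2 is exact.\<close>

definition mutate_qmat :: "ice_quiver \<Rightarrow> nat \<Rightarrow> nat \<Rightarrow> nat \<Rightarrow> int" where
  "mutate_qmat Q k i j =
     (if k = i \<or> k = j then - qmat Q i j
      else qmat Q i j + (\<bar>qmat Q i k\<bar> * qmat Q k j + qmat Q i k * \<bar>qmat Q k j\<bar>) div 2)"

text \<open>\<^const>\<open>nat\<close> truncates negative integers to 0, so this is the quiver without 2-cycles whose
  matrix is \<^const>\<open>mutate_qmat\<close>; see \<open>qmat_mutate_quiver\<close>.\<close>

definition mutate_quiver :: "nat \<Rightarrow> ice_quiver \<Rightarrow> ice_quiver" where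
  "mutate_quiver k Q = \<lparr>arrows = (\<lambda>i j. nat (mutate_qmat Q k i j)), frozen = frozen Q\<rparr>"

definition mutate_cluster :: "nat \<Rightarrow> nat \<Rightarrow> seed \<Rightarrow> nat \<Rightarrow> ratfun" where
  "mutate_cluster n k S =
     (case S of (Q, a) \<Rightarrow>
        a(k := ((\<Prod>j \<in> {j \<in> {1..n}. qmat Q k j > 0}. a j ^ nat (qmat Q k j)) +
                (\<Prod>j \<in> {j \<in> {1..n}. qmat Q k j < 0}. a j ^ nat (- qmat Q k j))) * inverse (a k)))"

definition mutate_seed :: "nat \<Rightarrow> nat \<Rightarrow> seed \<Rightarrow> seed" where
  "mutate_seed n k S = (mutate_quiver k (fst S), mutate_cluster n k S)"

inductive mutation_equivalent :: "nat \<Rightarrow> seed \<Rightarrow> seed \<Rightarrow> bool" for n S where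
  refl: "mutation_equivalent n S S"
| step: "mutation_equivalent n S T \<Longrightarrow> k \<in> mutable n (fst T) \<Longrightarrow>
         mutation_equivalent n S (mutate_seed n k T)"

lemma qmat_skew: "qmat Q j i = - qmat Q i j"
  by (simp add: qmat_def)

lemma mutate_qmat_skew: "mutate_qmat Q k j i = - mutate_qmat Q k i j"
proof -
  have even: "2 dvd (\<bar>x\<bar> * y + x * \<bar>y\<bar>)" for x y :: int
    by (cases "x \<ge> 0"; cases "y \<ge> 0") auto
  define x y where "x = qmat Q i k" and "y = qmat Q k j"
  have "(\<bar>y\<bar> * - x + - y * \<bar>x\<bar>) div 2 = - ((\<bar>x\<bar> * y + x * \<bar>y\<bar>) div 2)"
    using even[of x y] by (simp add: dvd_neg_div[symmetric] algebra_simps)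
  then show ?thesis
    using qmat_skew[of Q i k] qmat_skew[of Q k j] qmat_skew[of Q i j]
    by (auto simp: mutate_qmat_def x_def y_def)
qed

lemma qmat_mutate_quiver: "qmat (mutate_quiver k Q) i j = mutate_qmat Q k i j"
  using mutate_qmat_skew[of Q k i j] unfolding qmat_def mutate_quiver_def by simp

lemma is_ice_quiver_mutate:
  assumes "is_ice_quiver n Q"
  shows "is_ice_quiver n (mutate_quiver k Q)"
proof -
  have out: "qmat Q i j = 0" if "i \<notin> {1..n} \<or> j \<notin> {1..n}" for i j
    using assms that unfolding is_ice_quiver_def qmat_def
    by (metis bot_nat_0.not_eq_extremum diff_self of_nat_0)
  have "mutate_qmat Q k i j = 0" if "i \<notin> {1..n} \<or> j \<notin> {1..n}" for i j
    using that out by (auto simp: mutate_qmat_def)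
  then have "i \<in> {1..n} \<and> j \<in> {1..n}" if "mutate_qmat Q k i j > 0" for i j
    using that by (metis less_irrefl)
  moreover have "mutate_qmat Q k i i = 0" for i
    using mutate_qmat_skew[of Q k i i] by simp
  moreover have "\<not> (mutate_qmat Q k i j > 0 \<and> mutate_qmat Q k j i > 0)" for i j
    using mutate_qmat_skew[of Q k i j] by simp
  moreover have "frozen Q \<subseteq> {1..n}"
    using assms by (simp add: is_ice_quiver_def)
  ultimately show ?thesis
    unfolding is_ice_quiver_def mutate_quiver_def by auto
qed


section \<open>Cluster algebras\<close>

definition cluster_variables :: "nat \<Rightarrow> seed \<Rightarrow> ratfun set" where
  "cluster_variables n S = (\<Union>T \<in> {T. mutation_equivalent n S T}. snd T ` {1..n})"

text \<open>Mutation changes neither the frozen vertices nor the variables at them, so the frozen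
  variables may be read off from the given seed.\<close>

definition cluster_algebra :: "nat \<Rightarrow> seed \<Rightarrow> ratfun ring" where
  "cluster_algebra n S =
     (ratfun_field n)
       \<lparr>carrier := generate_ring (ratfun_field n)
          (cluster_variables n S \<union> (\<lambda>i. inverse (snd S i)) ` frozen (fst S))\<rparr>"


section \<open>Covering pairs\<close>

definition bi_infinite_path :: "nat \<Rightarrow> ice_quiver \<Rightarrow> (int \<Rightarrow> nat) \<Rightarrow> bool" where
  "bi_infinite_path n Q p \<longleftrightarrow> (\<forall>k. p k \<in> mutable n Q \<and> qmat Q (p k) (p (k + 1)) > 0)"

definition quiver_covering_pair :: "nat \<Rightarrow> ice_quiver \<Rightarrow> nat \<Rightarrow> nat \<Rightarrow> bool" where
  "quiver_covering_pair n Q i j \<longleftrightarrow>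
     i \<in> mutable n Q \<and> j \<in> mutable n Q \<and> arrows Q i j > 0 \<and>
     \<not> (\<exists>p. bi_infinite_path n Q p \<and> p 1 = i \<and> p 2 = j)"

definition covering_pair :: "nat \<Rightarrow> seed \<Rightarrow> ratfun \<Rightarrow> ratfun \<Rightarrow> bool" where
  "covering_pair n S a\<^sub>1 a\<^sub>2 \<longleftrightarrow>
     (\<exists>Q a i j. mutation_equivalent n S (Q, a) \<and> quiver_covering_pair n Q i j \<and>
                a\<^sub>1 = a i \<and> a\<^sub>2 = a j)"

end

theory Submission
  imports Defs
begin

text \<open>
  Let \<open>i \<rightarrow> j\<close> be an arrow between mutable vertices of a seed. The exchange relation at \<open>j\<close> reads
  \<open>a\<^sub>j a\<^sub>j' = P + N\<close>, where \<open>P\<close> is the product over the arrows out of \<open>j\<close> and \<open>N\<close>, the product over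
  the arrows into \<open>j\<close>, is a multiple of \<open>a\<^sub>i\<close>. So \<open>P\<close> lies in the ideal \<open>(a\<^sub>i, a\<^sub>j)\<close>. If \<open>a\<^sub>j\<close> is comaximal
  with \<open>a\<^sub>k\<close> for each mutable \<open>k\<close> with an arrow \<open>j \<rightarrow> k\<close>, then it is comaximal with \<open>P\<close>, the other factors
  of \<open>P\<close> being frozen variables and hence units; together these give \<open>(a\<^sub>i, a\<^sub>j) = (1)\<close>. If no infinite
  path of mutable vertices starts at \<open>j\<close>, this is an induction that proves \<open>(a\<^sub>i, a\<^sub>j) = (1)\<close>
  (\<open>comaximal_if_no_infinite_path\<close>); it begins at the vertices without mutable successors. If no infinite
  path ends at \<open>i\<close>, the same argument applies to the opposite quiver, since the exchange relations are
  symmetric in \<open>P\<close> and \<open>N\<close>. One of the two cases occurs, because infinite paths out of \<open>j\<close> and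
  into \<open>i\<close> could be joined along \<open>i \<rightarrow> j\<close> to a bi-infinite path.

  The ideal thus is the whole ring, and no prime ideal can contain it.

  Since \<open>0\<inverse> = 0\<close> here, the exchange relation \<open>a\<^sub>j a\<^sub>j' = P + N\<close> presupposes \<open>a\<^sub>j \<noteq> 0\<close> in every seed that
  can be reached by mutation. Cluster variables are subtraction-free expressions in the initial
  cluster \<open>a\<close>. Such an expression has the form \<open>p(a) / q(a)\<close> with polynomials \<open>p\<close> and \<open>q\<close> that are
  positive at \<open>(1, \<dots>, 1)\<close>. In particular \<open>p\<close> is not the zero polynomial, so \<open>p(a) \<noteq> 0\<close> by
  algebraic independence (\<open>zero_notin_semifield_hull\<close>).
\<close>


section \<open>Comaximal elements of a subring\<close>

locale unital_subring =
  fixes A :: "'a :: comm_ring_1 set"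
  assumes one_mem [simp]: "1 \<in> A"
    and add_mem [simp]: "x \<in> A \<Longrightarrow> y \<in> A \<Longrightarrow> x + y \<in> A"
    and mult_mem [simp]: "x \<in> A \<Longrightarrow> y \<in> A \<Longrightarrow> x * y \<in> A"
    and uminus_mem [simp]: "x \<in> A \<Longrightarrow> - x \<in> A"
begin

lemma zero_mem [simp]: "0 \<in> A"
  using add_mem[OF one_mem uminus_mem[OF one_mem]] by simp

lemma power_mem [simp]: "x \<in> A \<Longrightarrow> x ^ m \<in> A"
  by (induction m) auto

lemma prod_mem: "(\<And>k. k \<in> K \<Longrightarrow> f k \<in> A) \<Longrightarrow> prod f K \<in> A"
  by (induction K rule: infinite_finite_induct) auto

definition comaximal :: "'a \<Rightarrow> 'a \<Rightarrow> bool" where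
  "comaximal x y \<longleftrightarrow> (\<exists>u\<in>A. \<exists>v\<in>A. u * x + v * y = 1)"

lemma comaximal_commute: "comaximal x y \<longleftrightarrow> comaximal y x"
  unfolding comaximal_def by (metis add.commute)

lemma comaximal_unit:
  assumes "u \<in> A" "y * u = 1"
  shows "comaximal x y"
  unfolding comaximal_def using assms by (intro bexI[of _ 0] bexI[of _ u]) (auto simp: mult.commute)

lemma comaximal_mult:
  assumes "comaximal x y" "comaximal x z" "x \<in> A" "y \<in> A" "z \<in> A"
  shows "comaximal x (y * z)"
proof -
  obtain u v u' v' where mem: "u \<in> A" "v \<in> A" "u' \<in> A" "v' \<in> A"
    and eq: "u * x + v * y = 1" "u' * x + v' * z = 1"
    using assms(1,2) unfolding comaximal_def by blast
  have "(u * (u' * x + v' * z) + v * y * u') * x + (v * v') * (y * z)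
      = (u * x + v * y) * (u' * x + v' * z)"
    by (simp add: algebra_simps)
  also have "\<dots> = 1"
    by (simp add: eq)
  finally show ?thesis
    unfolding comaximal_def using mem assms(3-5)
    by (intro bexI[of _ "u * (u' * x + v' * z) + v * y * u'"] bexI[of _ "v * v'"]) auto
qed

lemma comaximal_power:
  assumes "comaximal x y" "x \<in> A" "y \<in> A"
  shows "comaximal x (y ^ m)"
  by (induction m) (simp_all add: comaximal_mult comaximal_unit[of 1] assms)

lemma comaximal_prod:
  assumes "\<And>k. k \<in> K \<Longrightarrow> comaximal x (f k)" "x \<in> A" "\<And>k. k \<in> K \<Longrightarrow> f k \<in> A"
  shows "comaximal x (prod f K)"
  using assms(1,3)
  by (induction K rule: infinite_finite_induct)
    (simp_all add: comaximal_mult comaximal_unit[of 1] prod_mem assms(2))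

text \<open>Modulo \<open>x\<close> and \<open>y\<close>, the hypothesis \<open>y * b = t + s * x\<close> makes \<open>t\<close> vanish, so an identity
  \<open>u * y + v * t = 1\<close> exhibits \<open>1\<close> as an element of the ideal generated by \<open>x\<close> and \<open>y\<close>.\<close>

lemma comaximal_exchange:
  assumes "comaximal y t" "y * b = t + s * x" "b \<in> A" "s \<in> A"
  shows "comaximal x y"
proof -
  obtain u v where mem: "u \<in> A" "v \<in> A" and eq: "u * y + v * t = 1"
    using assms(1) unfolding comaximal_def by blast
  have t: "t = y * b - s * x"
    using assms(2) by simp
  have "(- (v * s)) * x + (u + v * b) * y = u * y + v * t"
    unfolding t by (simp add: algebra_simps)
  then show ?thesis
    unfolding comaximal_def using mem assms(3,4) eq
    by (intro bexI[of _ "- (v * s)"] bexI[of _ "u + v * b"]) auto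
qed

text \<open>The accessibility predicate says that no infinite path of vertices in \<open>M\<close> starts
  at \<open>j\<close>. The matrix \<open>B\<close> and the set \<open>V\<close> are left general so that the lemma can also be applied to the
  opposite quiver, whose matrix is \<open>- B\<close>.\<close>

lemma comaximal_if_no_infinite_path:
  fixes B :: "'i \<Rightarrow> 'i \<Rightarrow> int"
  assumes "finite V" "M \<subseteq> V"
    and skew: "\<And>x y. B y x = - B x y"
    and c_mem: "\<And>k. k \<in> V \<Longrightarrow> c k \<in> A"
    and b_mem: "\<And>k. k \<in> M \<Longrightarrow> b k \<in> A"
    and unit: "\<And>k. k \<in> V - M \<Longrightarrow> \<exists>u\<in>A. c k * u = 1"
    and exchange: "\<And>k. k \<in> M \<Longrightarrow> c k * b k =
          (\<Prod>l \<in> {l \<in> V. B k l > 0}. c l ^ nat (B k l)) +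
          (\<Prod>l \<in> {l \<in> V. B k l < 0}. c l ^ nat (- B k l))"
    and acc: "Wellfounded.accp (\<lambda>k j. j \<in> M \<and> k \<in> M \<and> B j k > 0) j"
    and arrow: "i \<in> M" "j \<in> M" "B i j > 0"
  shows "comaximal (c i) (c j)"
  using acc arrow
proof (induction j arbitrary: i rule: accp.induct)
  case (accI j)
  let ?out = "{l \<in> V. B j l > 0}"
  let ?inc = "{l \<in> V. B j l < 0}"
  let ?t = "\<Prod>l\<in>?out. c l ^ nat (B j l)"
  let ?s = "c i ^ (nat (- B j i) - 1) * (\<Prod>l\<in>?inc - {i}. c l ^ nat (- B j l))"
  have cj: "c j \<in> A"
    using c_mem accI \<open>M \<subseteq> V\<close> by auto
  have "comaximal (c j) (c l)" if l: "l \<in> ?out" for l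
  proof (cases "l \<in> M")
    case True
    then show ?thesis
      using accI l by blast
  next
    case False
    then show ?thesis
      using unit[of l] l comaximal_unit by blast
  qed
  then have t: "comaximal (c j) ?t"
    by (intro comaximal_prod comaximal_power cj power_mem c_mem) auto
  have i: "i \<in> ?inc"
    using accI \<open>M \<subseteq> V\<close> skew[of i j] by auto
  \<comment> \<open>The arrow from \<open>i\<close> gives \<open>c i\<close> a positive exponent in the incoming product, which is
      therefore a multiple of \<open>c i\<close>.\<close>
  have "(\<Prod>l\<in>?inc. c l ^ nat (- B j l)) =
      c i ^ nat (- B j i) * (\<Prod>l\<in>?inc - {i}. c l ^ nat (- B j l))"
    using i \<open>finite V\<close> by (intro prod.remove) auto
  also have "c i ^ nat (- B j i) = c i ^ (nat (- B j i) - 1) * c i"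
    using i by (intro power_minus_mult[symmetric]) auto
  finally have "c j * b j = ?t + ?s * c i"
    using exchange[OF \<open>j \<in> M\<close>] by (simp add: mult_ac)
  moreover have "?s \<in> A"
    using i by (intro mult_mem power_mem prod_mem c_mem) auto
  ultimately show ?case
    using comaximal_exchange[OF t] b_mem \<open>j \<in> M\<close> by blast
qed

end


section \<open>Covering pairs and infinite paths\<close>

lemma not_accp_imp_infinite_path:
  assumes "\<not> Wellfounded.accp r x"
  shows "\<exists>f. f 0 = x \<and> (\<forall>m. r (f (Suc m)) (f m))"
proof -
  have "\<exists>f. \<forall>m. (\<not> Wellfounded.accp r (f m) \<and> (m = 0 \<longrightarrow> f m = x)) \<and> r (f (Suc m)) (f m)"
  proof (rule dependent_nat_choice)
    show "\<exists>y. \<not> Wellfounded.accp r y \<and> (0 = (0::nat) \<longrightarrow> y = x)"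
      using assms by blast
    show "\<exists>z. (\<not> Wellfounded.accp r z \<and> (Suc m = 0 \<longrightarrow> z = x)) \<and> r z y"
      if "\<not> Wellfounded.accp r y \<and> (m = 0 \<longrightarrow> y = x)" for y and m :: nat
      using that not_accp_down[of r y] by blast
  qed
  then show ?thesis
    by blast
qed

lemma quiver_covering_pair_qmat_pos:
  assumes "is_ice_quiver n Q" "quiver_covering_pair n Q i j"
  shows "qmat Q i j > 0"
proof -
  have "arrows Q i j > 0"
    using assms(2) by (simp add: quiver_covering_pair_def)
  moreover from this have "\<not> arrows Q j i > 0"
    using assms(1) unfolding is_ice_quiver_def by metis
  ultimately show ?thesis
    by (simp add: qmat_def)
qed

text \<open>An infinite path out of \<open>j\<close> and an infinite path into \<open>i\<close> could be joined along the arrow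
  \<open>i \<rightarrow> j\<close>, which would then lie in a bi-infinite path.\<close>

lemma covering_pair_no_infinite_path:
  assumes "is_ice_quiver n Q" "quiver_covering_pair n Q i j"
  shows "Wellfounded.accp (\<lambda>k j. j \<in> mutable n Q \<and> k \<in> mutable n Q \<and> qmat Q j k > 0) j \<or>
         Wellfounded.accp (\<lambda>k j. j \<in> mutable n Q \<and> k \<in> mutable n Q \<and> - qmat Q j k > 0) i"
proof (rule ccontr)
  let ?succ = "\<lambda>k j. j \<in> mutable n Q \<and> k \<in> mutable n Q \<and> qmat Q j k > 0"
  let ?pred = "\<lambda>k j. j \<in> mutable n Q \<and> k \<in> mutable n Q \<and> - qmat Q j k > 0"
  assume "\<not> (Wellfounded.accp ?succ j \<or> Wellfounded.accp ?pred i)"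
  then have not_acc: "\<not> Wellfounded.accp ?succ j" "\<not> Wellfounded.accp ?pred i"
    by simp_all
  obtain f where f: "f 0 = j"
    "\<And>m. f m \<in> mutable n Q \<and> f (Suc m) \<in> mutable n Q \<and> qmat Q (f m) (f (Suc m)) > 0"
    using not_accp_imp_infinite_path[OF not_acc(1)] by auto
  obtain g where g: "g 0 = i"
    "\<And>m. g m \<in> mutable n Q \<and> g (Suc m) \<in> mutable n Q \<and> - qmat Q (g m) (g (Suc m)) > 0"
    using not_accp_imp_infinite_path[OF not_acc(2)] by auto
  have ij: "qmat Q i j > 0"
    using assms by (rule quiver_covering_pair_qmat_pos)
  \<comment> \<open>The path into \<open>i\<close>, read backwards, ends at index 1, and the path out of \<open>j\<close> starts at index 2.\<close>
  define p where "p = (\<lambda>k::int. if k \<ge> 2 then f (nat (k - 2)) else g (nat (1 - k)))"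
  have "p k \<in> mutable n Q \<and> qmat Q (p k) (p (k + 1)) > 0" for k
  proof -
    consider "k \<ge> 2" | "k = 1" | "k \<le> 0"
      by linarith
    then show ?thesis
    proof cases
      case 1
      then have "nat (k + 1 - 2) = Suc (nat (k - 2))"
        by simp
      then show ?thesis
        using 1 f(2)[of "nat (k - 2)"] by (simp add: p_def)
    next
      case 2
      then show ?thesis
        using ij f(1) g(1) g(2)[of 0] by (simp add: p_def)
    next
      case 3
      then have "nat (1 - k) = Suc (nat (- k))"
        by simp
      then show ?thesis
        using 3 g(2)[of "nat (- k)"] qmat_skew[of Q "g (nat (- k))" "g (Suc (nat (- k)))"]
        by (simp add: p_def)
    qed
  qed
  then have "bi_infinite_path n Q p"
    by (simp add: bi_infinite_path_def)
  moreover have "p 1 = i" "p 2 = j"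
    using f(1) g(1) by (simp_all add: p_def)
  ultimately show False
    using assms(2) unfolding quiver_covering_pair_def by blast
qed


section \<open>Evaluation of polynomials\<close>

definition monomial_eval :: "('i \<Rightarrow> 'b :: comm_ring_1) \<Rightarrow> ('i \<Rightarrow>\<^sub>0 nat) \<Rightarrow> 'b" where
  "monomial_eval b m = (\<Prod>i \<in> Poly_Mapping.keys m. b i ^ Poly_Mapping.lookup m i)"

lemma monomial_eval_zero [simp]: "monomial_eval b 0 = 1"
  by (simp add: monomial_eval_def)

lemma monomial_eval_superset:
  assumes "finite K" "Poly_Mapping.keys m \<subseteq> K"
  shows "monomial_eval b m = (\<Prod>i \<in> K. b i ^ Poly_Mapping.lookup m i)"
  unfolding monomial_eval_def using assms
  by (intro prod.mono_neutral_left) (auto simp: in_keys_iff)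

lemma monomial_eval_add: "monomial_eval b (m + m') = monomial_eval b m * monomial_eval b m'"
proof -
  let ?K = "Poly_Mapping.keys m \<union> Poly_Mapping.keys m'"
  have "monomial_eval b (m + m') =
      (\<Prod>i\<in>?K. b i ^ Poly_Mapping.lookup m i * b i ^ Poly_Mapping.lookup m' i)"
    using keys_add[of m m'] by (subst monomial_eval_superset[of ?K])
      (auto simp: lookup_add power_add)
  also have "\<dots> = monomial_eval b m * monomial_eval b m'"
    by (simp add: prod.distrib monomial_eval_superset[of ?K])
  finally show ?thesis .
qed

text \<open>Two evaluations occur below: \<^const>\<open>qpoly_eval\<close> at a cluster, and the sum of the
  coefficients, with values in the rationals. Both change the coefficients by a ring homomorphism
  \<open>h\<close> and substitute \<open>b\<close> for the variables.\<close>

locale coefficient_hom =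
  fixes h :: "'c :: comm_ring_1 \<Rightarrow> 'b :: comm_ring_1"
  assumes h_zero [simp]: "h 0 = 0"
    and h_one [simp]: "h 1 = 1"
    and h_add: "h (x + y) = h x + h y"
    and h_mult: "h (x * y) = h x * h y"
begin

definition poly_eval :: "('i \<Rightarrow> 'b) \<Rightarrow> (('i \<Rightarrow>\<^sub>0 nat) \<Rightarrow>\<^sub>0 'c) \<Rightarrow> 'b" where
  "poly_eval b p =
     (\<Sum>m \<in> Poly_Mapping.keys p. h (Poly_Mapping.lookup p m) * monomial_eval b m)"

lemma poly_eval_zero [simp]: "poly_eval b 0 = 0"
  by (simp add: poly_eval_def)

lemma poly_eval_single [simp]:
  "poly_eval b (Poly_Mapping.single m c) = h c * monomial_eval b m"
  by (simp add: poly_eval_def)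

lemma poly_eval_one [simp]: "poly_eval b 1 = 1"
  using poly_eval_single[of b 0 1] by (simp del: poly_eval_single add: monomial_eval_def)

lemma poly_eval_add: "poly_eval b (p + q) = poly_eval b p + poly_eval b q"
  unfolding poly_eval_def
  by (rule setsum_keys_plus_distrib) (simp_all add: h_add distrib_right)

lemma poly_eval_sum: "poly_eval b (sum f K) = (\<Sum>k\<in>K. poly_eval b (f k))"
  by (induction K rule: infinite_finite_induct) (simp_all add: poly_eval_add)

lemma poly_eval_mult: "poly_eval b (p * q) = poly_eval b p * poly_eval b q"
proof -
  have expand: "r = (\<Sum>m\<in>Poly_Mapping.keys r. Poly_Mapping.single m (Poly_Mapping.lookup r m))"
    for r :: "('i \<Rightarrow>\<^sub>0 nat) \<Rightarrow>\<^sub>0 'c"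
    by (rule poly_mapping_eqI)
      (auto simp: lookup_sum lookup_single when_def in_keys_iff)
  have "poly_eval b (p * q) =
      poly_eval b (\<Sum>m\<in>Poly_Mapping.keys p. \<Sum>m'\<in>Poly_Mapping.keys q.
        Poly_Mapping.single (m + m') (Poly_Mapping.lookup p m * Poly_Mapping.lookup q m'))"
    by (subst (1) expand[of p], subst (1) expand[of q])
      (simp add: sum_product mult_single)
  also have "\<dots> = poly_eval b p * poly_eval b q"
    unfolding poly_eval_sum poly_eval_single h_mult monomial_eval_add
    by (simp add: poly_eval_def sum_product mult_ac)
  finally show ?thesis .
qed

end

interpretation coefficient_sum: coefficient_hom "id :: rat \<Rightarrow> rat"
  by unfold_locales auto

interpretation ratfun_coefficient: coefficient_hom ratfun_const
  by unfold_locales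
    (simp_all add: ratfun_const_def Zero_fract_def One_fract_def single_add mult_single)

lemma qpoly_eval_eq: "qpoly_eval = ratfun_coefficient.poly_eval"
  by (simp add: fun_eq_iff qpoly_eval_def ratfun_coefficient.poly_eval_def monomial_eval_def)


section \<open>Subtraction-free expressions do not vanish\<close>

inductive_set semifield_hull :: "'a :: Fields.field set \<Rightarrow> 'a set" for H where
  one: "1 \<in> semifield_hull H"
| incl: "x \<in> H \<Longrightarrow> x \<in> semifield_hull H"
| add: "x \<in> semifield_hull H \<Longrightarrow> y \<in> semifield_hull H \<Longrightarrow> x + y \<in> semifield_hull H"
| mult: "x \<in> semifield_hull H \<Longrightarrow> y \<in> semifield_hull H \<Longrightarrow> x * y \<in> semifield_hull H"
| inverse: "x \<in> semifield_hull H \<Longrightarrow> inverse x \<in> semifield_hull H"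

lemma semifield_hull_prod_power:
  "(\<And>k. k \<in> K \<Longrightarrow> f k \<in> semifield_hull H) \<Longrightarrow> (\<Prod>k\<in>K. f k ^ e k) \<in> semifield_hull H"
proof (induction K rule: infinite_finite_induct)
  case (insert k K)
  have "f k ^ m \<in> semifield_hull H" for m
    by (induction m) (auto intro: semifield_hull.intros insert.prems)
  then show ?case
    using insert by (auto intro: semifield_hull.intros)
qed (auto intro: semifield_hull.intros)

text \<open>Positivity of the sum of the coefficients, which is the value at \<open>(1, \<dots>, 1)\<close>, is preserved by
  sums and products because evaluation is a ring homomorphism, and it excludes the zero polynomial.\<close>

definition positive_at_ones :: "nat \<Rightarrow> qpoly \<Rightarrow> bool" where
  "positive_at_ones n p \<longleftrightarrow>
     (\<forall>m \<in> Poly_Mapping.keys p. Poly_Mapping.keys m \<subseteq> {1..n}) \<and>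
     coefficient_sum.poly_eval (\<lambda>_. 1) p > 0"

lemma positive_at_ones_one: "positive_at_ones n 1"
  by (simp add: positive_at_ones_def)

lemma positive_at_ones_add:
  assumes "positive_at_ones n p" "positive_at_ones n q"
  shows "positive_at_ones n (p + q)"
proof -
  have "Poly_Mapping.keys m \<subseteq> {1..n}" if m: "m \<in> Poly_Mapping.keys (p + q)" for m
    using assms subsetD[OF keys_add m] unfolding positive_at_ones_def by blast
  then show ?thesis
    using assms by (simp add: positive_at_ones_def coefficient_sum.poly_eval_add)
qed

lemma positive_at_ones_mult:
  assumes "positive_at_ones n p" "positive_at_ones n q"
  shows "positive_at_ones n (p * q)"
proof -
  have "Poly_Mapping.keys m \<subseteq> {1..n}" if m: "m \<in> Poly_Mapping.keys (p * q)" for m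
  proof -
    obtain x y where "m = x + y" "x \<in> Poly_Mapping.keys p" "y \<in> Poly_Mapping.keys q"
      using m keys_mult[of p q] by blast
    then show ?thesis
      using assms keys_add[of x y] unfolding positive_at_ones_def by blast
  qed
  then show ?thesis
    using assms by (simp add: positive_at_ones_def coefficient_sum.poly_eval_mult)
qed

lemma qpoly_eval_nonzero:
  assumes "algebraically_independent n a" "positive_at_ones n p"
  shows "qpoly_eval a p \<noteq> 0"
proof
  assume "qpoly_eval a p = 0"
  then have "p = 0"
    using assms unfolding algebraically_independent_def positive_at_ones_def by blast
  then show False
    using assms(2) by (simp add: positive_at_ones_def)
qed

lemma semifield_hull_quotient:
  assumes indep: "algebraically_independent n a"
    and "x \<in> semifield_hull (a ` {1..n})"
  shows "\<exists>p q. positive_at_ones n p \<and> positive_at_ones n q \<and> x = qpoly_eval a p / qpoly_eval a q"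
  using assms(2)
proof induction
  case one
  show ?case
    by (intro exI[of _ 1]) (simp add: positive_at_ones_one qpoly_eval_eq)
next
  case (incl x)
  then obtain i where i: "i \<in> {1..n}" "x = a i"
    by auto
  let ?p = "Poly_Mapping.single (Poly_Mapping.single i 1) 1 :: qpoly"
  have "positive_at_ones n ?p" "qpoly_eval a ?p = x"
    using i by (simp_all add: positive_at_ones_def qpoly_eval_eq monomial_eval_def)
  then show ?case
    by - (rule exI[of _ ?p], rule exI[of _ 1], simp add: positive_at_ones_one qpoly_eval_eq)
next
  case (add x y)
  then obtain p q p' q' where
    pos: "positive_at_ones n p" "positive_at_ones n q" "positive_at_ones n p'" "positive_at_ones n q'"
    and eq: "x = qpoly_eval a p / qpoly_eval a q" "y = qpoly_eval a p' / qpoly_eval a q'"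
    by blast
  show ?case
  proof (intro exI conjI)
    have "qpoly_eval a q \<noteq> 0" "qpoly_eval a q' \<noteq> 0"
      using qpoly_eval_nonzero[OF indep] pos by auto
    then show "x + y = qpoly_eval a (p * q' + p' * q) / qpoly_eval a (q * q')"
      unfolding eq qpoly_eval_eq ratfun_coefficient.poly_eval_add ratfun_coefficient.poly_eval_mult
      by (rule add_frac_eq)
  qed (simp_all add: pos positive_at_ones_add positive_at_ones_mult)
next
  case (mult x y)
  then obtain p q p' q' where
    pos: "positive_at_ones n p" "positive_at_ones n q" "positive_at_ones n p'" "positive_at_ones n q'"
    and eq: "x = qpoly_eval a p / qpoly_eval a q" "y = qpoly_eval a p' / qpoly_eval a q'"
    by blast
  show ?case
  proof (intro exI conjI)
    show "x * y = qpoly_eval a (p * p') / qpoly_eval a (q * q')"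
      by (simp add: eq qpoly_eval_eq ratfun_coefficient.poly_eval_mult)
  qed (simp_all add: pos positive_at_ones_mult)
next
  case (inverse x)
  then obtain p q where "positive_at_ones n p" "positive_at_ones n q"
    "x = qpoly_eval a p / qpoly_eval a q"
    by blast
  then show ?case
    by - (rule exI[of _ q], rule exI[of _ p], simp)
qed

lemma zero_notin_semifield_hull:
  assumes "algebraically_independent n a"
  shows "0 \<notin> semifield_hull (a ` {1..n})"
proof
  assume "0 \<in> semifield_hull (a ` {1..n})"
  then obtain p q where "positive_at_ones n p" "positive_at_ones n q"
    "0 = qpoly_eval a p / qpoly_eval a q"
    using semifield_hull_quotient[OF assms] by blast
  then show False
    using qpoly_eval_nonzero[OF assms] by simp
qed


section \<open>Seeds obtained by mutation\<close>

text \<open>The exchange relation writes the new variable with sums, products and inverses only, so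
  mutation never leaves the hull of the initial cluster. Frozen variables persist because mutation
  changes the cluster at a mutable vertex only.\<close>

lemma mutation_equivalent_invariants:
  assumes "mutation_equivalent n S T" "is_ice_quiver n (fst S)"
  shows "is_ice_quiver n (fst T) \<and> frozen (fst T) = frozen (fst S) \<and>
         (\<forall>k \<in> frozen (fst S). snd T k = snd S k) \<and>
         (\<forall>k \<in> {1..n}. snd T k \<in> semifield_hull (snd S ` {1..n}))"
  using assms
proof induction
  case refl
  then show ?case
    by (auto intro: semifield_hull.incl)
next
  case (step T k)
  obtain Q a where T: "T = (Q, a)"
    by (cases T)
  have IH: "is_ice_quiver n Q" "frozen Q = frozen (fst S)"
    "\<forall>k \<in> frozen (fst S). a k = snd S k" "\<forall>k \<in> {1..n}. a k \<in> semifield_hull (snd S ` {1..n})"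
    and k: "k \<in> {1..n}" "k \<notin> frozen (fst S)"
    using step T by (auto simp: mutable_def)
  have "mutate_cluster n k (Q, a) k \<in> semifield_hull (snd S ` {1..n})"
    unfolding mutate_cluster_def using IH(4) k
    by (auto intro!: semifield_hull.add semifield_hull.mult semifield_hull.inverse
        semifield_hull_prod_power)
  moreover have other: "mutate_cluster n k (Q, a) l = a l" if "l \<noteq> k" for l
    using that by (simp add: mutate_cluster_def)
  ultimately have "mutate_cluster n k (Q, a) l \<in> semifield_hull (snd S ` {1..n})"
    if "l \<in> {1..n}" for l
    using IH(4) that by (cases "l = k") simp_all
  moreover have "mutate_cluster n k (Q, a) l = snd S l" if "l \<in> frozen (fst S)" for l
    using IH(3) k that other by (cases "l = k") simp_all
  moreover have "is_ice_quiver n (mutate_quiver k Q)" "frozen (mutate_quiver k Q) = frozen (fst S)"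
    using IH(1,2) by (simp_all add: is_ice_quiver_mutate) (simp add: mutate_quiver_def)
  ultimately show ?case
    by (simp add: mutate_seed_def T)
qed

lemma mutate_cluster_exchange:
  assumes "a k \<noteq> 0"
  shows "a k * mutate_cluster n k (Q, a) k =
      (\<Prod>j \<in> {j \<in> {1..n}. qmat Q k j > 0}. a j ^ nat (qmat Q k j)) +
      (\<Prod>j \<in> {j \<in> {1..n}. qmat Q k j < 0}. a j ^ nat (- qmat Q k j))"
  using assms by (simp add: mutate_cluster_def)


section \<open>The cluster algebra as a subring of the field of rational functions\<close>

lemma ratfun_field_simps:
  "x \<oplus>\<^bsub>ratfun_field n\<^esub> y = x + y" "x \<otimes>\<^bsub>ratfun_field n\<^esub> y = x * y"
  "\<one>\<^bsub>ratfun_field n\<^esub> = 1" "\<zero>\<^bsub>ratfun_field n\<^esub> = 0"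
  by (simp_all add: ratfun_field_def ring_of_type_algebra_def)

lemma cluster_algebra_simps:
  "x \<oplus>\<^bsub>cluster_algebra n S\<^esub> y = x + y" "x \<otimes>\<^bsub>cluster_algebra n S\<^esub> y = x * y"
  "\<one>\<^bsub>cluster_algebra n S\<^esub> = 1" "\<zero>\<^bsub>cluster_algebra n S\<^esub> = 0"
  by (simp_all add: cluster_algebra_def ratfun_field_simps)

lemma field_ratfun_field: "Ring.field (ratfun_field n)"
proof -
  have "Ring.field (ring_of_type_algebra :: ratfun ring)"
    by (rule field_from_type_algebra)
  then show ?thesis
    unfolding ratfun_field_def
    by (rule field.generate_field_is_field) (simp add: ring_of_type_algebra_def)
qed

lemma inverse_mem_ratfun_field:
  assumes "x \<in> carrier (ratfun_field n)"
  shows "inverse x \<in> carrier (ratfun_field n)"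
proof (cases "x = 0")
  case True
  then show ?thesis
    using assms by simp
next
  case False
  interpret F: Ring.field "ratfun_field n"
    by (rule field_ratfun_field)
  have x: "x \<in> Units (ratfun_field n)"
    using False assms by (simp add: F.field_Units ratfun_field_simps)
  then have "inv\<^bsub>ratfun_field n\<^esub> x * x = 1"
    using F.Units_l_inv[OF x] by (simp add: ratfun_field_simps)
  then have "inv\<^bsub>ratfun_field n\<^esub> x = inverse x"
    using False by (simp add: field_simps)
  then show ?thesis
    using F.Units_inv_closed[OF x] by simp
qed

lemma semifield_hull_subset_ratfun_field:
  assumes "H \<subseteq> carrier (ratfun_field n)"
  shows "semifield_hull H \<subseteq> carrier (ratfun_field n)"
proof
  interpret F: Ring.field "ratfun_field n"
    by (rule field_ratfun_field)
  show "x \<in> carrier (ratfun_field n)" if "x \<in> semifield_hull H" for x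
    using that
  proof induction
    case one
    show ?case
      using F.one_closed by (simp add: ratfun_field_simps)
  next
    case (add x y)
    then show ?case
      using F.a_closed[of x y] by (simp add: ratfun_field_simps)
  next
    case (mult x y)
    then show ?case
      using F.m_closed[of x y] by (simp add: ratfun_field_simps)
  qed (use assms inverse_mem_ratfun_field in auto)
qed

lemma seed_cluster_subset:
  assumes "is_seed n S"
  shows "snd S ` {1..n} \<subseteq> carrier (ratfun_field n)"
  using assms generate_field.incl[of _ "snd S ` {1..n}" "ratfun_field n"]
  unfolding is_seed_def by (auto split: prod.splits)

lemma ring_cluster_algebra:
  assumes "is_seed n S"
  shows "ring (cluster_algebra n S)"
proof -
  interpret F: Ring.field "ratfun_field n"
    by (rule field_ratfun_field)
  have quiver: "is_ice_quiver n (fst S)"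
    using assms unfolding is_seed_def by (auto split: prod.splits)
  have "cluster_variables n S \<subseteq> carrier (ratfun_field n)"
    using mutation_equivalent_invariants[OF _ quiver]
      semifield_hull_subset_ratfun_field[OF seed_cluster_subset[OF assms]]
    unfolding cluster_variables_def by blast
  moreover have "inverse (snd S i) \<in> carrier (ratfun_field n)" if "i \<in> frozen (fst S)" for i
  proof -
    have "i \<in> {1..n}"
      using that quiver unfolding is_ice_quiver_def by blast
    then show ?thesis
      using seed_cluster_subset[OF assms] by (intro inverse_mem_ratfun_field) blast
  qed
  ultimately show ?thesis
    unfolding cluster_algebra_def by (intro F.generate_ring_is_ring) auto
qed

lemma unital_subring_cluster_algebra:
  assumes "is_seed n S"
  shows "unital_subring (carrier (cluster_algebra n S))"
proof -
  interpret R: ring "cluster_algebra n S"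
    by (rule ring_cluster_algebra[OF assms])
  show ?thesis
  proof
    show "- x \<in> carrier (cluster_algebra n S)" if x: "x \<in> carrier (cluster_algebra n S)" for x
    proof -
      have "\<ominus>\<^bsub>cluster_algebra n S\<^esub> x + x = 0"
        using R.l_neg[OF x] by (simp add: cluster_algebra_simps)
      then have "\<ominus>\<^bsub>cluster_algebra n S\<^esub> x = - x"
        by (simp add: eq_neg_iff_add_eq_0)
      then show ?thesis
        using R.a_inv_closed[OF x] by simp
    qed
  qed (use R.one_closed R.a_closed R.m_closed in \<open>simp_all add: cluster_algebra_simps\<close>)
qed


section \<open>Covering pairs are comaximal\<close>

lemma covering_pair_comaximal:
  assumes seed: "is_seed n S" and "covering_pair n S x y"
  shows "x \<in> carrier (cluster_algebra n S)" "y \<in> carrier (cluster_algebra n S)"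
    "unital_subring.comaximal (carrier (cluster_algebra n S)) x y"
proof -
  let ?A = "carrier (cluster_algebra n S)"
  interpret A: unital_subring ?A
    by (rule unital_subring_cluster_algebra[OF seed])
  obtain Q a i j where equiv: "mutation_equivalent n S (Q, a)"
    and cover: "quiver_covering_pair n Q i j" and xy: "x = a i" "y = a j"
    using assms(2) unfolding covering_pair_def by blast
  have S: "is_ice_quiver n (fst S)" "algebraically_independent n (snd S)"
    using seed unfolding is_seed_def by (auto split: prod.splits)
  have inv: "is_ice_quiver n Q" "frozen Q = frozen (fst S)" "\<forall>k \<in> frozen Q. a k = snd S k"
    "\<forall>k \<in> {1..n}. a k \<in> semifield_hull (snd S ` {1..n})"
    using mutation_equivalent_invariants[OF equiv S(1)] by auto
  have nonzero: "a k \<noteq> 0" if "k \<in> {1..n}" for k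
    using that inv(4) zero_notin_semifield_hull[OF S(2)] by metis
  have var: "snd T k \<in> ?A" if "mutation_equivalent n S T" "k \<in> {1..n}" for T k
    using that by (auto simp: cluster_algebra_def cluster_variables_def intro!: generate_ring.incl)
  let ?b = "\<lambda>k. mutate_cluster n k (Q, a) k"
  let ?M = "mutable n Q"
  have M: "?M \<subseteq> {1..n}"
    by (auto simp: mutable_def)
  have c_mem: "a k \<in> ?A" if "k \<in> {1..n}" for k
    using var[OF equiv that] by simp
  have b_mem: "?b k \<in> ?A" if "k \<in> ?M" for k
    using var[OF mutation_equivalent.step[OF equiv], of k k] that M by (auto simp: mutate_seed_def)
  have unit: "\<exists>u\<in>?A. a k * u = 1" if k: "k \<in> {1..n} - ?M" for k
  proof -
    have "k \<in> frozen (fst S)" "a k = snd S k"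
      using k inv by (auto simp: mutable_def)
    then have "inverse (a k) \<in> ?A"
      by (auto simp: cluster_algebra_def intro!: generate_ring.incl)
    then show ?thesis
      using nonzero[of k] k by (intro bexI[of _ "inverse (a k)"]) auto
  qed
  have exchange: "a k * ?b k =
      (\<Prod>j \<in> {j \<in> {1..n}. qmat Q k j > 0}. a j ^ nat (qmat Q k j)) +
      (\<Prod>j \<in> {j \<in> {1..n}. qmat Q k j < 0}. a j ^ nat (- qmat Q k j))" if "k \<in> ?M" for k
    using that M nonzero by (intro mutate_cluster_exchange) auto
  have ij: "i \<in> ?M" "j \<in> ?M" "qmat Q i j > 0"
    using cover quiver_covering_pair_qmat_pos[OF inv(1) cover]
    by (simp_all add: quiver_covering_pair_def)
  show "x \<in> ?A" "y \<in> ?A"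
    using ij M c_mem xy by auto
  from covering_pair_no_infinite_path[OF inv(1) cover] show "A.comaximal x y"
  proof
    assume acc: "Wellfounded.accp (\<lambda>k j. j \<in> ?M \<and> k \<in> ?M \<and> qmat Q j k > 0) j"
    show ?thesis
      unfolding xy
      by (rule A.comaximal_if_no_infinite_path[where V = "{1..n}" and B = "qmat Q" and b = ?b,
            OF _ M qmat_skew c_mem b_mem unit exchange acc ij]) simp_all
  next
    \<comment> \<open>The opposite quiver contains the arrow \<open>j \<rightarrow> i\<close>, so \<open>i\<close> and \<open>j\<close> change places.\<close>
    assume acc: "Wellfounded.accp (\<lambda>k j. j \<in> ?M \<and> k \<in> ?M \<and> - qmat Q j k > 0) i"
    have skew: "- qmat Q y x = - (- qmat Q x y)" for x y
      using qmat_skew[of Q y x] by simp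
    have exchange': "a k * ?b k =
        (\<Prod>l \<in> {l \<in> {1..n}. - qmat Q k l > 0}. a l ^ nat (- qmat Q k l)) +
        (\<Prod>l \<in> {l \<in> {1..n}. - qmat Q k l < 0}. a l ^ nat (- (- qmat Q k l)))" if "k \<in> ?M" for k
      unfolding exchange[OF that] by (simp add: add.commute)
    have ji: "- qmat Q j i > 0"
      using ij(3) qmat_skew[of Q j i] by simp
    have "A.comaximal (a j) (a i)"
      by (rule A.comaximal_if_no_infinite_path[where V = "{1..n}" and B = "\<lambda>x y. - qmat Q x y"
            and b = ?b, OF _ M skew c_mem b_mem unit exchange' acc ij(2,1) ji]) simp_all
    then show ?thesis
      unfolding xy by (subst A.comaximal_commute)
  qed
qed

theorem lemma5p3:
  fixes n :: nat and S :: seed and a\<^sub>1 a\<^sub>2 :: ratfun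
  assumes "is_seed n S"
    and "covering_pair n S a\<^sub>1 a\<^sub>2"
  shows "(\<nexists>P. primeideal P (cluster_algebra n S) \<and> a\<^sub>1 \<in> P \<and> a\<^sub>2 \<in> P) \<and>
         Idl\<^bsub>cluster_algebra n S\<^esub> {a\<^sub>1, a\<^sub>2} = carrier (cluster_algebra n S)"
proof -
  let ?R = "cluster_algebra n S"
  interpret R: ring ?R
    by (rule ring_cluster_algebra[OF assms(1)])
  interpret A: unital_subring "carrier ?R"
    by (rule unital_subring_cluster_algebra[OF assms(1)])
  note mem = covering_pair_comaximal(1,2)[OF assms]
  obtain u v where uv: "u \<in> carrier ?R" "v \<in> carrier ?R" "u * a\<^sub>1 + v * a\<^sub>2 = 1"
    using covering_pair_comaximal(3)[OF assms] unfolding A.comaximal_def by blast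
  have whole: "I = carrier ?R" if I: "ideal I ?R" "a\<^sub>1 \<in> I" "a\<^sub>2 \<in> I" for I
  proof -
    interpret I: ideal I ?R
      by (rule I(1))
    have "u \<otimes>\<^bsub>?R\<^esub> a\<^sub>1 \<oplus>\<^bsub>?R\<^esub> v \<otimes>\<^bsub>?R\<^esub> a\<^sub>2 \<in> I"
      using I uv by (intro I.a_closed I.I_l_closed) auto
    then have "\<one>\<^bsub>?R\<^esub> \<in> I"
      using uv(3) by (simp add: cluster_algebra_simps)
    then show ?thesis
      by (rule I.one_imp_carrier)
  qed
  have "\<not> (primeideal P ?R \<and> a\<^sub>1 \<in> P \<and> a\<^sub>2 \<in> P)" for P
    using whole[of P] primeideal.I_notcarr[of P ?R] primeideal.axioms(1)[of P ?R] by blast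
  moreover have "Idl\<^bsub>?R\<^esub> {a\<^sub>1, a\<^sub>2} = carrier ?R"
    using mem R.genideal_ideal[of "{a\<^sub>1, a\<^sub>2}"] R.genideal_self[of "{a\<^sub>1, a\<^sub>2}"] by (intro whole) auto
  ultimately show ?thesis
    by blast
qed

end
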